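(* Let $\mathcal{H}$ be a fixed $3$-uniform hypergraph with $t$ vertices. Then for all sufficiently large $n$, every $\mathcal{H}$-free $3$-uniform hypergraph $\mathcal{G}$ on $n$ vertices contains a complete or empty tripartite subgraph each part of which has order at least $(\log n)^{\frac{1}{2} + \delta(\mathcal{H})}$, where $\delta(\mathcal{H}) = 1/(55t^2)$. That is, there are pairwise disjoint vertex sets $U, V, W$ of $\mathcal{G}$, each of size at least $(\log n)^{\frac12 + \frac{1}{55t^2}}$, such that either every triple $\{u,v,w\}$ with $u\in U, v \in V, w \in W$ is an edge of $\mathcal{G}$, or no such triple is an edge of $\mathcal{G}$.
   Context: A $3$-uniform hypergraph $\mathcal{G}$ is $\mathcal{H}$-free if it contains no induced copy of $\mathcal{H}$, i.e. there is no injection of $V(\mathcal{H})$ into $V(\mathcal{G})$ under which a triple of $V(\mathcal{H})$ is an edge of $\mathcal{H}$ if and only if its image is an edge of $\mathcal{G}$. Logarithms are natural. *)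

theory Defs
  imports Complex_Main "HOL-Library.Ramsey"
begin

definition three_uniform_hypergraph :: "'a set \<Rightarrow> 'a set set \<Rightarrow> bool" where
  "three_uniform_hypergraph V E \<longleftrightarrow> finite V \<and> E \<subseteq> [V]\<^bsup>3\<^esup>"

definition contains_induced_copy ::
    "'a set \<Rightarrow> 'a set set \<Rightarrow> 'b set \<Rightarrow> 'b set set \<Rightarrow> bool" where
  "contains_induced_copy VH EH VG EG \<longleftrightarrow>
     (\<exists>f. inj_on f VH \<and> f ` VH \<subseteq> VG \<and> (\<forall>T \<in> [VH]\<^bsup>3\<^esup>. T \<in> EH \<longleftrightarrow> f ` T \<in> EG))"

definition induced_free ::
    "'a set \<Rightarrow> 'a set set \<Rightarrow> 'b set \<Rightarrow> 'b set set \<Rightarrow> bool" where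
  "induced_free VH EH VG EG \<longleftrightarrow> \<not> contains_induced_copy VH EH VG EG"

definition complete_tripartite :: "'a set set \<Rightarrow> 'a set \<Rightarrow> 'a set \<Rightarrow> 'a set \<Rightarrow> bool" where
  "complete_tripartite E U V W \<longleftrightarrow> (\<forall>u\<in>U. \<forall>v\<in>V. \<forall>w\<in>W. {u, v, w} \<in> E)"

definition empty_tripartite :: "'a set set \<Rightarrow> 'a set \<Rightarrow> 'a set \<Rightarrow> 'a set \<Rightarrow> bool" where
  "empty_tripartite E U V W \<longleftrightarrow> (\<forall>u\<in>U. \<forall>v\<in>V. \<forall>w\<in>W. {u, v, w} \<notin> E)"

text \<open>
  Here \<open>t\<close> is the number of vertices of the forbidden hypergraph.  The HOL value \<open>delta 0 = 0\<close>
  is immaterial: no hypergraph is free of the hypergraph without vertices.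
\<close>

definition delta :: "nat \<Rightarrow> real" where
  "delta t = 1 / (55 * (real t)\<^sup>2)"

end

theory Submission
  imports Defs "HOL-Real_Asymp.Real_Asymp"
begin

text \<open>
  Put \<open>L = ln n\<close>, \<open>\<epsilon> = L powr (-3\<delta>)\<close>, and split the vertices of \<open>G\<close> into \<open>t\<close> parts of size \<open>N\<close>.  Impose the
  constraints of \<open>H\<close> on transversals one triple at a time.  Adding a vertex to a partial copy imposes
  fewer than \<open>t\<^sup>2\<close> constraints, so if every constraint kept an \<open>\<epsilon>\<close>-fraction of the maps, each vertex
  would have at least an \<open>\<epsilon> ^ t\<^sup>2\<close>-fraction of the possible extensions and a copy of \<open>H\<close> would appear.  Hence
  some constraint \<open>{i, k, l}\<close> fails.  Averaging over the images of the other vertices leaves a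
  tripartite graph with at least about \<open>\<kappa> N\<^sup>3\<close> triangles, \<open>\<kappa> = \<epsilon> ^ (3t\<^sup>2) = L powr (-9/55)\<close>, almost all of which are
  triples of the same colour.

  In such a triad restrict to pairs \<open>ab\<close> that lie in many triangles, almost all of the right colour,
  and find a complete bipartite subgraph \<open>A' \<times> B'\<close> of these, with \<open>A'\<close> of size about \<open>\<kappa> L\<close> and \<open>B'\<close> of size
  \<open>exp (L powr (1/2 - 3\<delta>/2))\<close>.  For many \<open>c\<close> the link is a large product set in which wrong pairs have
  density at most \<open>2\<epsilon>\<close>, so it contains an \<open>s \<times> s\<close> product without wrong pairs, \<open>s = L powr (1/2 + \<delta>)\<close>.  The number of
  such products in \<open>A' \<times> B'\<close> is a small power of \<open>n\<close>, so many \<open>c\<close> share one.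
\<close>

section \<open>Averaging and bipartite graphs\<close>

text \<open>Points with value below \<open>m / 2\<close> account for at most half of the guaranteed
  total, so the others carry the rest at no more than \<open>M\<close> each. Values of
  \<open>f\<close> may be negative, which allows the signed weights used for triads.\<close>

lemma popular:
  fixes f :: "'a \<Rightarrow> real" and m M :: real
  assumes "finite X" "\<And>x. x \<in> X \<Longrightarrow> f x \<le> M" "m * card X \<le> sum f X" "0 \<le> m"
  shows "m / 2 * card X \<le> M * card {x \<in> X. m / 2 \<le> f x}"
proof -
  let ?G = "{x \<in> X. m / 2 \<le> f x}"
  have "sum f X = sum f ?G + sum f (X - ?G)"
    using assms(1) by (metis (no_types, lifting) add.commute mem_Collect_eq subsetI sum.subset_diff)
  moreover have "sum f ?G \<le> card ?G * M"
    using assms(2) by (intro sum_bounded_above) auto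
  moreover have "sum f (X - ?G) \<le> card (X - ?G) * (m / 2)"
    by (intro sum_bounded_above) auto
  moreover have "card (X - ?G) * (m / 2) \<le> card X * (m / 2)"
    using assms(1,4) by (intro mult_right_mono) (auto intro: card_mono)
  ultimately show ?thesis
    using assms(3) by (simp add: algebra_simps)
qed

lemma large_fibre:
  fixes k :: real
  assumes "finite X" "finite Y" "Y \<noteq> {}" "f ` X \<subseteq> Y" "k * card Y \<le> card X"
  obtains y where "y \<in> Y" "k \<le> card {x \<in> X. f x = y}"
proof -
  have "\<exists>y\<in>Y. k \<le> card {x \<in> X. f x = y}"
  proof (rule ccontr)
    assume "\<not> ?thesis"
    then have "(\<Sum>y\<in>Y. real (card {x \<in> X. f x = y})) < (\<Sum>y\<in>Y. k)"
      using assms(2,3) by (intro sum_strict_mono) (auto simp: not_le)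
    moreover have "card X = (\<Sum>y\<in>Y. card {x \<in> X. f x = y})"
      using sum.group[OF assms(1,2,4), of "\<lambda>_. 1::nat"] by simp
    ultimately show False using assms(5) by (simp add: mult.commute)
  qed
  then show thesis using that by blast
qed

text \<open>Fix \<open>p\<close> vertices of \<open>A\<close> of large degree. A proportion
  \<open>d / 4\<close> of \<open>B\<close> has at least \<open>d / 4 * p\<close> neighbours among
  them, and pigeonhole over the \<open>2 ^ p\<close> possible neighbourhoods makes one of them,
  \<open>A'\<close>, common to many vertices.\<close>

lemma dense_bipartite_complete:
  fixes d :: real
  assumes fin: "finite A" "finite B" and d: "0 < d"
    and dens: "d * card A * card B \<le> (\<Sum>a\<in>A. \<Sum>b\<in>B. of_bool (R a b))"
    and p: "0 < p" "real p \<le> d / 2 * card A" and B: "B \<noteq> {}"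
  obtains A' B' where "A' \<subseteq> A" "B' \<subseteq> B" "card A' \<le> p" "d / 4 * p \<le> card A'"
    "d / 4 * card B / 2 ^ p \<le> card B'" "\<forall>a\<in>A'. \<forall>b\<in>B'. R a b"
proof -
  let ?A = "{a \<in> A. d * card B / 2 \<le> (\<Sum>b\<in>B. of_bool (R a b))}"
  have "d * card B / 2 * card A \<le> real (card B) * real (card ?A)"
    using fin d dens by (intro popular) (auto simp: Int_def mult_ac intro: card_mono)
  then have "d / 2 * card A \<le> card ?A"
    using B fin by (simp add: field_simps card_gt_0_iff)
  with p(2) have "p \<le> card ?A" by linarith
  then obtain A1 where A1: "A1 \<subseteq> ?A" "card A1 = p"
    by (meson obtain_subset_with_card_n)
  have finA1: "finite A1" using A1(1) fin(1) by (auto intro: finite_subset)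
  let ?B = "{b \<in> B. d / 2 * p / 2 \<le> (\<Sum>a\<in>A1. of_bool (R a b))}"
  have "(\<Sum>a\<in>A1. d * card B / 2) \<le> (\<Sum>a\<in>A1. \<Sum>b\<in>B. of_bool (R a b))"
    using A1 by (intro sum_mono) auto
  also have "\<dots> = (\<Sum>b\<in>B. \<Sum>a\<in>A1. of_bool (R a b))" by (rule sum.swap)
  finally have sumB: "d / 2 * p * card B \<le> (\<Sum>b\<in>B. \<Sum>a\<in>A1. of_bool (R a b))"
    using A1(2) by (simp add: mult_ac)
  have "d / 2 * p / 2 * card B \<le> real p * real (card ?B)"
    using fin finA1 d sumB A1(2)
    by (intro popular) (auto simp: Int_def intro: card_mono)
  then have cB: "d / 4 * card B \<le> card ?B" using p(1) by (simp add: field_simps)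
  let ?f = "\<lambda>b. {a \<in> A1. R a b}"
  obtain A' where A': "A' \<in> Pow A1" "d / 4 * card B / 2 ^ p \<le> card {b \<in> ?B. ?f b = A'}"
    using cB finA1 fin A1(2) by (elim large_fibre[where Y = "Pow A1" and f = ?f and X = ?B, rotated -1])
      (auto simp: card_Pow)
  \<comment> \<open>The fibre must be nonempty, since the lower bound on \<open>card A'\<close> is
    read off from one of its members.\<close>
  have pos: "0 < d / 4 * card B / 2 ^ p" using d B fin by (simp add: card_gt_0_iff)
  have "0 < real (card {b \<in> ?B. ?f b = A'})" using A'(2) pos by linarith
  then have "{b \<in> ?B. ?f b = A'} \<noteq> {}" by (metis card.empty of_nat_0 less_irrefl)
  then obtain b where b: "b \<in> ?B" "?f b = A'" by blast
  show thesis
  proof (rule that[OF _ _ _ _ A'(2)])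
    show "d / 4 * p \<le> card A'"
      using b finA1 by (auto simp: Int_def)
    show "card A' \<le> p" using A'(1) A1(2) finA1 by (auto intro: card_mono)
  qed (use A' A1 in auto)
qed

lemma sparse_bipartite_empty:
  fixes \<theta> :: real
  assumes fin: "finite X" "finite Y" and \<theta>: "0 \<le> \<theta>" "\<theta> \<le> 1"
    and deg: "\<And>y. y \<in> Y \<Longrightarrow> card {x \<in> X. R x y} \<le> \<theta> * (card X - s)"
    and s: "s \<le> card X" and j: "j \<le> s"
  shows "\<exists>X0 Y0. X0 \<subseteq> X \<and> Y0 \<subseteq> Y \<and> card X0 = j \<and> (1 - \<theta>) ^ j * card Y \<le> card Y0 \<and>
           (\<forall>x\<in>X0. \<forall>y\<in>Y0. \<not> R x y)"
  using j
proof (induction j)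
  case 0
  show ?case by (intro exI[of _ "{}"] exI[of _ Y]) auto
next
  case (Suc j)
  then obtain X0 Y0 where IH: "X0 \<subseteq> X" "Y0 \<subseteq> Y" "card X0 = j" 
    "(1 - \<theta>) ^ j * card Y \<le> card Y0" "\<forall>x\<in>X0. \<forall>y\<in>Y0. \<not> R x y" by auto
  have finY0: "finite Y0" and finX0: "finite X0" using IH fin finite_subset by blast+
  have cX: "card (X - X0) = card X - j" using IH finX0 by (simp add: card_Diff_subset)
  then have cX': "real (card X - s) \<le> card (X - X0)" "card (X - X0) > 0"
    using Suc.prems s by auto
  then have ne: "X - X0 \<noteq> {}" by force
  have "\<exists>x\<in>X - X0. real (card {y \<in> Y0. R x y}) \<le> \<theta> * card Y0"
  proof (rule ccontr)
    assume "\<not> ?thesis"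
    then have "(\<Sum>x\<in>X - X0. \<theta> * card Y0) < (\<Sum>x\<in>X - X0. real (card {y \<in> Y0. R x y}))"
      using ne fin by (intro sum_strict_mono) (auto simp: not_le)
    also have "\<dots> = (\<Sum>x\<in>X - X0. \<Sum>y\<in>Y0. of_bool (R x y))"
      using finY0 by (simp add: Int_def)
    also have "\<dots> = (\<Sum>y\<in>Y0. \<Sum>x\<in>X - X0. of_bool (R x y))" by (rule sum.swap)
    also have "\<dots> \<le> (\<Sum>y\<in>Y0. \<Sum>x\<in>X. of_bool (R x y))"
      using fin by (intro sum_mono sum_mono2) auto
    also have "\<dots> = (\<Sum>y\<in>Y0. real (card {x \<in> X. R x y}))" using fin by (simp add: Int_def)
    also have "\<dots> \<le> (\<Sum>y\<in>Y0. \<theta> * (card X - s))"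
      using deg IH(2) by (intro sum_mono) (use s in \<open>auto simp: of_nat_diff\<close>)
    also have "\<dots> \<le> (\<Sum>y\<in>Y0. \<theta> * card (X - X0))"
      using \<theta>(1) cX'(1) s by (intro sum_mono mult_left_mono) auto
    finally show False by (simp add: mult_ac)
  qed
  then obtain x where x: "x \<in> X - X0" "real (card {y \<in> Y0. R x y}) \<le> \<theta> * card Y0" by blast
  let ?Y = "{y \<in> Y0. \<not> R x y}"
  have "card Y0 = card {y \<in> Y0. R x y} + card ?Y"
    using finY0 by (subst card_Un_disjoint[symmetric]) (auto intro: arg_cong[where f = card])
  with x(2) have "(1 - \<theta>) * card Y0 \<le> card ?Y" by (simp add: algebra_simps)
  moreover have "(1 - \<theta>) * ((1 - \<theta>) ^ j * card Y) \<le> (1 - \<theta>) * card Y0"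
    using IH(4) \<theta> by (intro mult_left_mono) auto
  ultimately have "(1 - \<theta>) ^ Suc j * card Y \<le> card ?Y" by (simp add: mult_ac)
  then show ?case
    using IH x finX0 by (intro exI[of _ "insert x X0"] exI[of _ ?Y]) auto
qed

section \<open>Nearly monochromatic triads\<close>

text \<open>One signed weight carries two facts through the averaging: as it is at most
  \<open>2 * \<epsilon>\<close>, a large sum forces many triangles, and a nonnegative sum bounds the
  proportion of bad ones by \<open>2 * \<epsilon>\<close>. The bounds on \<open>p\<close> and
  \<open>q\<close> serve the product of heavy pairs, those on \<open>s\<close> the sparse links, and
  \<open>N\<close> the final pigeonhole.\<close>

lemma triad_empty_tripartite:
  fixes \<epsilon> \<kappa> :: real and N s p q :: nat
  assumes fin: "finite A" "finite B" "finite C"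
    and card: "card A = N" "card B = N" "card C = N"
    and eps: "0 < \<epsilon>" "\<epsilon> \<le> 1 / 16" and kap: "0 < \<kappa>" and s0: "0 < s"
    and p: "0 < p" "p \<le> \<kappa> / 8 * N"
    and q: "q \<le> \<kappa> / 16 * N / 2 ^ p"
    and s: "2 * s \<le> \<kappa>\<^sup>2 * p / 128" "s \<le> (1 - 8 * \<epsilon>) ^ s * (\<kappa> * q / 32)"
    and N: "s * (2 ^ p * q ^ s) \<le> \<kappa> / 8 * N"
    and triad: "\<epsilon> * \<kappa> * N ^ 3 \<le> (\<Sum>a\<in>A. \<Sum>b\<in>B. \<Sum>c\<in>C.
      if P1 a b \<and> P2 a c \<and> P3 b c then 2 * \<epsilon> - of_bool (bad a b c) else 0)"
  obtains U V W where "U \<subseteq> A" "V \<subseteq> B" "W \<subseteq> C" "s \<le> card U" "s \<le> card V" "s \<le> card W"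
    "\<forall>a\<in>U. \<forall>b\<in>V. \<forall>c\<in>W. \<not> bad a b c"
proof -
  define w where "w = (\<lambda>a b c. if P1 a b \<and> P2 a c \<and> P3 b c then 2 * \<epsilon> - of_bool (bad a b c) else 0)"
  define f where "f = (\<lambda>a b. \<Sum>c\<in>C. w a b c)"
  define R where "R = (\<lambda>a b. \<epsilon> * \<kappa> * N / 2 \<le> f a b)"
  have w_le: "w a b c \<le> 2 * \<epsilon>" for a b c using eps by (auto simp: w_def)
  have N0: "0 < N" using p by (cases N) auto
  have q0: "0 < q" using s(2) s0 by (cases q) auto
  have f_le: "f a b \<le> 2 * \<epsilon> * N" for a b
    using sum_bounded_above[of C "w a b" "2 * \<epsilon>"] w_le card by (simp add: f_def mult_ac)
  have "\<epsilon> * \<kappa> * N / 2 * card (A \<times> B)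
      \<le> 2 * \<epsilon> * N * card {x \<in> A \<times> B. \<epsilon> * \<kappa> * N / 2 \<le> (case x of (a, b) \<Rightarrow> f a b)}"
    using fin card triad f_le eps kap
    by (intro popular)
       (auto simp: card_cartesian_product sum.cartesian_product[symmetric] power3_eq_cube f_def w_def mult_ac)
  moreover have "{x \<in> A \<times> B. \<epsilon> * \<kappa> * N / 2 \<le> (case x of (a, b) \<Rightarrow> f a b)} = Sigma A (\<lambda>a. {b \<in> B. R a b})"
    by (auto simp: R_def)
  moreover have "card (Sigma A (\<lambda>a. {b \<in> B. R a b})) = (\<Sum>a\<in>A. card {b \<in> B. R a b})"
    using fin by simp
  moreover have "real (\<Sum>a\<in>A. card {b \<in> B. R a b}) = (\<Sum>a\<in>A. \<Sum>b\<in>B. of_bool (R a b))"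
    using fin by (simp add: Int_def)
  ultimately have "\<epsilon> * \<kappa> * N / 2 * (N * N) \<le> 2 * \<epsilon> * N * (\<Sum>a\<in>A. \<Sum>b\<in>B. of_bool (R a b))"
    using card by (simp add: card_cartesian_product)
  then have dens: "\<kappa> / 4 * card A * card B \<le> (\<Sum>a\<in>A. \<Sum>b\<in>B. of_bool (R a b))"
    using eps N0 card by (simp add: field_simps)
  obtain A' B'' where A': "A' \<subseteq> A" "B'' \<subseteq> B" "card A' \<le> p" "\<kappa> / 4 / 4 * p \<le> card A'"
    "\<kappa> / 4 / 4 * card B / 2 ^ p \<le> card B''" "\<forall>a\<in>A'. \<forall>b\<in>B''. R a b"
  proof (rule dense_bipartite_complete[OF fin(1,2) _ dens p(1)])
    show "0 < \<kappa> / 4" using kap by simp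
    show "real p \<le> \<kappa> / 4 / 2 * card A" using p card by simp
    show "B \<noteq> {}" using card N0 by auto
  qed
  have "real q \<le> card B''" using A'(5) q card by simp
  then obtain B' where B': "B' \<subseteq> B''" "card B' = q"
    by (meson obtain_subset_with_card_n of_nat_le_iff)
  have finA': "finite A'" and finB': "finite B'"
    using A' B' fin by (meson finite_subset)+
  have R: "R a b" if "a \<in> A'" "b \<in> B'" for a b using that A' B' by blast
  have P1: "P1 a b" if "a \<in> A'" "b \<in> B'" for a b
  proof (rule ccontr)
    assume "\<not> P1 a b"
    then have "f a b = 0" by (simp add: f_def w_def)
    with R[OF that] eps kap N0 show False by (auto simp: R_def mult_le_0_iff)
  qed
  have a0: "0 < card A'" using A'(4) kap p(1) by (cases "card A' = 0") (auto simp: mult_le_0_iff)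
  define g where "g = (\<lambda>c. \<Sum>a\<in>A'. \<Sum>b\<in>B'. w a b c)"
  define Cg where "Cg = {c \<in> C. \<epsilon> * \<kappa> * card A' * q / 2 / 2 \<le> g c}"
  have g_le: "g c \<le> 2 * \<epsilon> * card A' * q" for c
  proof -
    have "g c \<le> (\<Sum>a\<in>A'. \<Sum>b\<in>B'. 2 * \<epsilon>)" unfolding g_def by (intro sum_mono w_le)
    then show ?thesis using B'(2) by (simp add: mult_ac)
  qed
  have "(\<Sum>a\<in>A'. \<Sum>b\<in>B'. \<epsilon> * \<kappa> * N / 2) \<le> (\<Sum>a\<in>A'. \<Sum>b\<in>B'. f a b)"
    using R by (intro sum_mono) (auto simp: R_def)
  also have "\<dots> = sum g C"
    unfolding g_def f_def by (simp only: sum.swap[of _ _ C])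
  finally have "\<epsilon> * \<kappa> * card A' * q / 2 * card C \<le> sum g C" using card B'(2) by (simp add: mult_ac)
  then have "\<epsilon> * \<kappa> * card A' * q / 2 / 2 * card C \<le> 2 * \<epsilon> * card A' * q * card Cg"
    unfolding Cg_def using fin g_le eps kap by (intro popular) auto
  then have cCg: "\<kappa> / 8 * N \<le> card Cg" using eps a0 q0 card by (simp add: field_simps)
  have ex: "\<exists>X. fst X \<subseteq> A' \<and> snd X \<subseteq> B' \<and> card (fst X) = s \<and> card (snd X) = s \<and>
      (\<forall>a\<in>fst X. \<forall>b\<in>snd X. \<not> bad a b c)" if c: "c \<in> Cg" for c
  proof -
    define Ac Bc where "Ac = {a \<in> A'. P2 a c}" and "Bc = {b \<in> B'. P3 b c}"
    have finc: "finite Ac" "finite Bc" using finA' finB' by (auto simp: Ac_def Bc_def)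
    have "g c = (\<Sum>a\<in>A'. if P2 a c then \<Sum>b\<in>B'. if P3 b c then 2 * \<epsilon> - of_bool (bad a b c) else 0 else 0)"
      unfolding g_def w_def using P1 by (intro sum.cong refl) (auto intro!: sum.cong)
    also have "\<dots> = (\<Sum>a\<in>Ac. \<Sum>b\<in>Bc. 2 * \<epsilon> - of_bool (bad a b c))"
      using finA' finB' by (simp add: Ac_def Bc_def sum.inter_filter)
    also have "\<dots> = (\<Sum>b\<in>Bc. 2 * \<epsilon> * card Ac - card {a \<in> Ac. bad a b c})"
      using finc by (subst sum.swap) (simp add: sum_subtractf Int_def mult_ac)
    finally have gc: "g c = (\<Sum>b\<in>Bc. 2 * \<epsilon> * card Ac - card {a \<in> Ac. bad a b c})" .
    \<comment> \<open>Ignoring the bad pairs bounds the size of the link from below; as its sides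
      lie in \<open>A'\<close> and \<open>B'\<close>, each of them must be large.\<close>
    have "g c \<le> (\<Sum>b\<in>Bc. 2 * \<epsilon> * card Ac)" unfolding gc by (intro sum_mono) auto
    with c have "\<epsilon> * (\<kappa> * card A' * q / 4) \<le> \<epsilon> * (2 * card Ac * card Bc)" by (simp add: Cg_def mult_ac)
    then have AB: "\<kappa> * card A' * q \<le> 8 * real (card Ac) * card Bc" using eps(1) by simp
    have le: "card Ac \<le> card A'" "card Bc \<le> q"
      using finA' finB' B'(2) by (auto simp: Ac_def Bc_def intro!: card_mono)
    have "8 * real (card Ac) * card Bc \<le> 8 * real (card Ac) * q" using le by (intro mult_left_mono) auto
    with AB have "\<kappa> * card A' * q \<le> 8 * real (card Ac) * q" by linarith
    then have Ac: "\<kappa> * card A' \<le> 8 * card Ac" using q0 by simp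
    have "8 * real (card Ac) * card Bc \<le> 8 * real (card A') * card Bc"
      using le by (intro mult_right_mono) auto
    with AB have "card A' * (\<kappa> * q) \<le> card A' * (8 * real (card Bc))" by (simp add: mult_ac)
    then have Bc: "\<kappa> * q \<le> 8 * card Bc" using a0 by simp
    have "\<kappa> * (\<kappa> / 4 / 4 * p) \<le> \<kappa> * card A'" using A'(4) kap by (intro mult_left_mono) auto
    with Ac have "\<kappa>\<^sup>2 * p / 128 \<le> card Ac" by (simp add: power2_eq_square)
    with s(1) have Ac2: "2 * s \<le> card Ac" by linarith
    have "0 < \<epsilon> * \<kappa> * card A' * q / 2 / 2" using eps kap a0 q0 by simp
    with c have "0 \<le> g c" by (simp add: Cg_def)
    \<comment> \<open>Adding \<open>2 * \<epsilon> * card Ac\<close> to every term makes the average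
      positive, so that \<open>popular\<close> applies: at least a quarter of \<open>Bc\<close> has
      bad degree at most \<open>3 * \<epsilon> * card Ac\<close>.\<close>
    then have sm: "2 * \<epsilon> * card Ac * card Bc \<le> (\<Sum>b\<in>Bc. 4 * \<epsilon> * card Ac - card {a \<in> Ac. bad a b c})"
      unfolding gc by (simp add: sum_subtractf mult_ac)
    define Y where "Y = {b \<in> Bc. 2 * \<epsilon> * card Ac / 2 \<le> 4 * \<epsilon> * card Ac - card {a \<in> Ac. bad a b c}}"
    have "2 * \<epsilon> * card Ac / 2 * card Bc \<le> 4 * \<epsilon> * card Ac * card Y"
      unfolding Y_def using finc eps sm by (intro popular) auto
    then have Y: "card Bc \<le> 4 * real (card Y)" using eps Ac2 s0 by (simp add: field_simps)
    \<comment> \<open>Passing to \<open>8 * \<epsilon>\<close> pays for the \<open>s\<close>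
      vertices reserved by the greedy choice, as \<open>2 * s \<le> card Ac\<close>.\<close>
    have deg: "card {x \<in> Ac. bad x y c} \<le> 8 * \<epsilon> * real (card Ac - s)" if "y \<in> Y" for y
    proof -
      have "card {x \<in> Ac. bad x y c} \<le> 4 * \<epsilon> * card Ac"
        using that eps(1) zero_le_mult_iff[of \<epsilon> "card Ac"] by (simp add: Y_def)
      also have "\<dots> \<le> 4 * \<epsilon> * (2 * (card Ac - s))"
        using Ac2 eps by (intro mult_left_mono) (auto simp: of_nat_diff)
      finally show ?thesis using Ac2 by (simp add: of_nat_diff mult_ac)
    qed
    have "finite Y" using finc by (simp add: Y_def)
    from sparse_bipartite_empty[of Ac Y "8 * \<epsilon>" "\<lambda>a b. bad a b c" s s, OF finc(1) this _ _ deg]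
    obtain X0 Y0 where XY: "X0 \<subseteq> Ac" "Y0 \<subseteq> Y" "card X0 = s"
      "(1 - 8 * \<epsilon>) ^ s * card Y \<le> card Y0" "\<forall>x\<in>X0. \<forall>y\<in>Y0. \<not> bad x y c"
      using eps Ac2 by auto
    have "(1 - 8 * \<epsilon>) ^ s * (\<kappa> * q / 32) \<le> (1 - 8 * \<epsilon>) ^ s * card Y"
      using Bc Y eps by (intro mult_left_mono) auto
    with s(2) XY(4) have "s \<le> card Y0" by linarith
    then obtain Y1 where "Y1 \<subseteq> Y0" "card Y1 = s" by (meson obtain_subset_with_card_n)
    then show ?thesis using XY by (intro exI[of _ "(X0, Y1)"]) (auto simp: Ac_def Bc_def Y_def)
  qed
  then obtain h where h: "\<And>c. c \<in> Cg \<Longrightarrow> fst (h c) \<subseteq> A' \<and> snd (h c) \<subseteq> B' \<and> card (fst (h c)) = s \<and>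
      card (snd (h c)) = s \<and> (\<forall>a\<in>fst (h c). \<forall>b\<in>snd (h c). \<not> bad a b c)"
    by metis
  \<comment> \<open>Since \<open>A'\<close> has at most \<open>p\<close> elements, counting all its
    subsets costs only \<open>2 ^ p\<close>; in \<open>B'\<close>, which is large in the
    application, only sets of size \<open>s\<close> are counted.\<close>
  define \<Y> where "\<Y> = Pow A' \<times> {V. V \<subseteq> B' \<and> card V = s}"
  have "0 < card Cg" using cCg kap N0 by (cases "card Cg = 0") (auto simp: mult_le_0_iff)
  then have "finite Cg" "Cg \<noteq> {}" by (auto simp: card_gt_0_iff)
  have hY: "h ` Cg \<subseteq> \<Y>"
  proof (rule image_subsetI)
    fix c assume "c \<in> Cg"
    from h[OF this] show "h c \<in> \<Y>" by (cases "h c") (auto simp: \<Y>_def)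
  qed
  then have "\<Y> \<noteq> {}" using \<open>Cg \<noteq> {}\<close> by auto
  have "finite \<Y>" using finA' finB' by (simp add: \<Y>_def)
  have "s \<le> q"
    using \<open>Cg \<noteq> {}\<close> h finB' B'(2) by (metis all_not_in_conv card_mono)
  have "card \<Y> = 2 ^ card A' * (q choose s)"
    using finA' finB' B'(2) by (simp add: \<Y>_def card_cartesian_product card_Pow n_subsets)
  also have "\<dots> \<le> 2 ^ p * q ^ s"
    using A'(3) \<open>s \<le> q\<close> by (intro mult_mono power_increasing binomial_le_pow) auto
  finally have "s * card \<Y> \<le> s * (2 ^ p * q ^ s)" by simp
  then have "real (s * card \<Y>) \<le> real (s * (2 ^ p * q ^ s))" by (simp only: of_nat_le_iff)
  with N cCg have "real s * card \<Y> \<le> card Cg" by simp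
  from large_fibre[OF \<open>finite Cg\<close> \<open>finite \<Y>\<close> \<open>\<Y> \<noteq> {}\<close> hY this]
  obtain y where y: "y \<in> \<Y>" "real s \<le> card {c \<in> Cg. h c = y}" .
  have "{c \<in> Cg. h c = y} \<noteq> {}" using y(2) s0 by (metis card.empty of_nat_0 of_nat_0_less_iff not_le)
  then obtain c where c: "c \<in> Cg" "h c = y" by blast
  show thesis
  proof (rule that[of "fst y" "snd y" "{c \<in> Cg. h c = y}"])
    show "fst y \<subseteq> A" "snd y \<subseteq> B" "s \<le> card (fst y)" "s \<le> card (snd y)"
      using h[OF c(1)] c(2) A' B' by auto
    show "\<forall>a\<in>fst y. \<forall>b\<in>snd y. \<forall>c\<in>{c \<in> Cg. h c = y}. \<not> bad a b c" using h by blast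
  qed (use y in \<open>auto simp: Cg_def\<close>)
qed

section \<open>Counting partial induced copies\<close>

text \<open>For disjoint \<open>V i\<close> and \<open>C\<close> the set of all triples of
  \<open>S\<close>, these are the induced copies that send each \<open>i\<close> into
  \<open>V i\<close>. Keeping \<open>C\<close> variable lets the constraints be imposed one at a
  time.\<close>

definition correct_maps ::
    "'a set set \<Rightarrow> 'b set set \<Rightarrow> ('a \<Rightarrow> 'b set) \<Rightarrow> 'a set \<Rightarrow> 'a set set \<Rightarrow> ('a \<Rightarrow> 'b) set" where
  "correct_maps EH EG V S C = {x \<in> PiE S V. \<forall>T\<in>C. T \<in> EH \<longleftrightarrow> x ` T \<in> EG}"

text \<open>
  The sum is \<open>2\<epsilon>\<close> times the number of triangles of the tripartite graph \<open>P1, P2, P3\<close> minus the number of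
  triangles of colour \<open>\<sigma>\<close>.  A lower bound on it records at once that there are many triangles
  and that few of them have colour \<open>\<sigma>\<close>.
\<close>

definition sparse_triad :: "'b set set \<Rightarrow> real \<Rightarrow> real \<Rightarrow> 'b set \<Rightarrow> 'b set \<Rightarrow> 'b set \<Rightarrow> bool" where
  "sparse_triad EG \<epsilon> \<mu> A B C \<longleftrightarrow> (\<exists>P1 P2 P3 \<sigma>. \<mu> \<le> (\<Sum>a\<in>A. \<Sum>b\<in>B. \<Sum>c\<in>C.
     if P1 a b \<and> P2 a c \<and> P3 b c then 2 * \<epsilon> - of_bool (({a, b, c} \<in> EG) = \<sigma>) else 0))"

lemma finite_correct_maps:
  "finite S \<Longrightarrow> (\<And>i. i \<in> S \<Longrightarrow> finite (V i)) \<Longrightarrow> finite (correct_maps EH EG V S C)"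
  by (rule finite_subset[of _ "PiE S V"]) (auto simp: correct_maps_def intro: finite_PiE)

lemma sum_PiE_insert:
  assumes "i \<notin> S"
  shows "(\<Sum>x\<in>PiE (insert i S) V. F x) = (\<Sum>y\<in>PiE S V. \<Sum>a\<in>V i. F (y(i := a)))"
proof -
  have "(\<Sum>x\<in>PiE (insert i S) V. F x) = (\<Sum>(a, y)\<in>V i \<times> PiE S V. F (y(i := a)))"
    unfolding PiE_insert_eq using inj_combinator[OF assms]
    by (subst sum.reindex) (auto simp: case_prod_unfold)
  also have "\<dots> = (\<Sum>y\<in>PiE S V. \<Sum>a\<in>V i. F (y(i := a)))"
    by (subst sum.cartesian_product[symmetric]) (rule sum.swap)
  finally show ?thesis .
qed

text \<open>By \<open>fail\<close>, the weight \<open>2 * \<epsilon>\<close> minus the indicator of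
  the new constraint sums to more than \<epsilon> times the number of maps correct for
  \<open>C\<close>. By \<open>large\<close>, these maps have few restrictions to
  \<open>S - {i, k, l}\<close>, so one restriction carries weight at least
  \<open>\<epsilon> * \<mu>\<close>. With it fixed, the possible images of \<open>i, k, l\<close>
  form the triad.\<close>

lemma triad_of_failing_triple:
  fixes \<epsilon> \<mu> :: real
  assumes finS: "finite S" and finV: "\<And>i. i \<in> S \<Longrightarrow> finite (V i)"
    and dist: "i \<in> S" "k \<in> S" "l \<in> S" "i \<noteq> k" "i \<noteq> l" "k \<noteq> l"
    and C: "C \<subseteq> [S]\<^bsup>3\<^esup>" "{i, k, l} \<notin> C" "[S - {i, k, l}]\<^bsup>3\<^esup> \<subseteq> C"
    and eps: "0 < \<epsilon>"
    and fail: "card (correct_maps EH EG V S (insert {i, k, l} C)) < \<epsilon> * card (correct_maps EH EG V S C)"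
    and large: "\<mu> * card (correct_maps EH EG V (S - {i, k, l}) ([S - {i, k, l}]\<^bsup>3\<^esup>))
      \<le> card (correct_maps EH EG V S C)"
  shows "sparse_triad EG \<epsilon> (\<epsilon> * \<mu>) (V i) (V k) (V l)"
proof -
  define S' where "S' = S - {i, k, l}"
  define M where "M = correct_maps EH EG V S C"
  define ok where "ok = (\<lambda>x T. T \<in> EH \<longleftrightarrow> x ` T \<in> EG)"
  define Y where "Y = correct_maps EH EG V S' ([S']\<^bsup>3\<^esup>)"
  define w where "w = (\<lambda>x. if x \<in> M then 2 * \<epsilon> - of_bool (ok x {i, k, l}) else 0)"
  define G where "G = (\<lambda>y. \<Sum>a\<in>V i. \<Sum>b\<in>V k. \<Sum>c\<in>V l. w (y(i := a, k := b, l := c)))"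
  have S: "S = insert l (insert k (insert i S'))" using dist by (auto simp: S'_def)
  have nin: "i \<notin> S'" "k \<notin> insert i S'" "l \<notin> insert k (insert i S')"
    using dist by (auto simp: S'_def)
  have finP: "finite (PiE S V)" "finite (PiE S' V)"
    using finS finV by (auto simp: S'_def intro!: finite_PiE)
  have "M \<subseteq> PiE S V" by (auto simp: M_def correct_maps_def)
  then have finM: "finite M" using finP(1) by (rule finite_subset)
  have "sum w (PiE S V) = sum w M"
    by (rule sum.mono_neutral_right) (use finP \<open>M \<subseteq> PiE S V\<close> in \<open>auto simp: w_def\<close>)
  also have "\<dots> = (\<Sum>x\<in>M. 2 * \<epsilon> - of_bool (ok x {i, k, l}))" by (simp add: w_def)
  also have "\<dots> = 2 * \<epsilon> * card M - card {x \<in> M. ok x {i, k, l}}"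
    using finM by (simp add: sum_subtractf Int_def)
  also have "{x \<in> M. ok x {i, k, l}} = correct_maps EH EG V S (insert {i, k, l} C)"
    by (auto simp: M_def correct_maps_def ok_def)
  finally have "\<epsilon> * card M < sum w (PiE S V)" using fail by (simp add: M_def algebra_simps)
  also have "sum w (PiE S V) = sum G (PiE S' V)"
    unfolding S G_def by (simp only: sum_PiE_insert[OF nin(3)] sum_PiE_insert[OF nin(2)] sum_PiE_insert[OF nin(1)])
  also have "\<dots> = sum G Y"
  proof (rule sum.mono_neutral_right)
    \<comment> \<open>A restriction violating a triple inside \<open>S'\<close> has no extension in
      \<open>M\<close>, because \<open>C\<close> contains all such triples.\<close>
    show "\<forall>y\<in>PiE S' V - Y. G y = 0"
    proof
      fix y assume y: "y \<in> PiE S' V - Y"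
      then obtain T where T: "T \<in> [S']\<^bsup>3\<^esup>" "\<not> ok y T" by (auto simp: Y_def correct_maps_def ok_def)
      have "y(i := a, k := b, l := c) \<notin> M" for a b c
      proof -
        have "T \<in> C" using T(1) C(3) by (auto simp: S'_def)
        moreover have "y(i := a, k := b, l := c) ` T = y ` T"
          using T(1) by (intro image_cong) (auto simp: S'_def nsets_def)
        then have "\<not> ok (y(i := a, k := b, l := c)) T" using T(2) by (simp only: ok_def simp_thms)
        ultimately show ?thesis unfolding M_def correct_maps_def ok_def by blast
      qed
      then show "G y = 0" by (simp add: G_def w_def)
    qed
  qed (use finP in \<open>auto simp: Y_def correct_maps_def\<close>)
  finally have lt: "\<epsilon> * card M < sum G Y" .
  have "\<epsilon> * \<mu> * card Y \<le> \<epsilon> * card M"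
    using large eps by (simp add: M_def Y_def S'_def)
  with lt have "card Y * (\<epsilon> * \<mu>) < sum G Y" by (simp add: mult_ac)
  then obtain y where y: "y \<in> Y" "\<epsilon> * \<mu> \<le> G y"
    using sum_bounded_above[of Y G "\<epsilon> * \<mu>"] by (metis less_eq_real_def linorder_not_le)
  have yP: "y \<in> PiE S' V" using y(1) by (auto simp: Y_def correct_maps_def)
  \<comment> \<open>Every triple in \<open>C\<close> misses one of \<open>i, k, l\<close>, so given \<open>y\<close> its constraint concerns only two of \<open>a, b, c\<close>.\<close>
  define P1 where "P1 = (\<lambda>a b. \<forall>T\<in>C. l \<notin> T \<longrightarrow> ok (y(i := a, k := b)) T)"
  define P2 where "P2 = (\<lambda>a c. \<forall>T\<in>C. k \<notin> T \<longrightarrow> ok (y(i := a, l := c)) T)"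
  define P3 where "P3 = (\<lambda>b c. \<forall>T\<in>C. i \<notin> T \<longrightarrow> ok (y(k := b, l := c)) T)"
  have w: "w (y(i := a, k := b, l := c)) = (if P1 a b \<and> P2 a c \<and> P3 b c
      then 2 * \<epsilon> - of_bool (({a, b, c} \<in> EG) = ({i, k, l} \<in> EH)) else 0)"
    if abc: "a \<in> V i" "b \<in> V k" "c \<in> V l" for a b c
  proof -
    define x where "x = y(i := a, k := b, l := c)"
    have "x \<in> PiE S V"
      using yP abc dist unfolding S x_def by (intro PiE_fun_upd) auto
    then have "x \<in> M \<longleftrightarrow> (\<forall>T\<in>C. ok x T)"
      unfolding M_def correct_maps_def ok_def by blast
    also have "\<dots> \<longleftrightarrow> P1 a b \<and> P2 a c \<and> P3 b c"
    proof -
      have eq: "x ` T = (y(i := a, k := b)) ` T" if "l \<notin> T" for T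
        using that by (intro image_cong) (auto simp: x_def)
      have l: "ok x T = ok (y(i := a, k := b)) T" if "l \<notin> T" for T
        by (simp only: ok_def eq[OF that])
      have eq: "x ` T = (y(i := a, l := c)) ` T" if "k \<notin> T" for T
        using that by (intro image_cong) (auto simp: x_def)
      have k: "ok x T = ok (y(i := a, l := c)) T" if "k \<notin> T" for T
        by (simp only: ok_def eq[OF that])
      have eq: "x ` T = (y(k := b, l := c)) ` T" if "i \<notin> T" for T
        using that by (intro image_cong) (auto simp: x_def)
      have i: "ok x T = ok (y(k := b, l := c)) T" if "i \<notin> T" for T
        by (simp only: ok_def eq[OF that])
      have "i \<notin> T \<or> k \<notin> T \<or> l \<notin> T" if "T \<in> C" for T
      proof (rule ccontr)
        assume "\<not> ?thesis"
        then have "{i, k, l} \<subseteq> T" by auto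
        moreover have "finite T" "card T = 3" using that C(1) by (auto simp: nsets_def)
        moreover have "card {i, k, l} = 3" using dist by simp
        ultimately have "{i, k, l} = T" by (simp add: card_subset_eq)
        with that C(2) show False by simp
      qed
      moreover have "P1 a b \<longleftrightarrow> (\<forall>T\<in>C. l \<notin> T \<longrightarrow> ok x T)"
        unfolding P1_def using l by (intro ball_cong refl imp_cong) auto
      moreover have "P2 a c \<longleftrightarrow> (\<forall>T\<in>C. k \<notin> T \<longrightarrow> ok x T)"
        unfolding P2_def using k by (intro ball_cong refl imp_cong) auto
      moreover have "P3 b c \<longleftrightarrow> (\<forall>T\<in>C. i \<notin> T \<longrightarrow> ok x T)"
        unfolding P3_def using i by (intro ball_cong refl imp_cong) auto
      ultimately show ?thesis by blast
    qed
    finally have "x \<in> M \<longleftrightarrow> P1 a b \<and> P2 a c \<and> P3 b c" .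
    moreover have "x ` {i, k, l} = {a, b, c}" using dist by (auto simp: x_def)
    ultimately show ?thesis unfolding w_def x_def[symmetric] by (auto simp: ok_def)
  qed
  have "G y = (\<Sum>a\<in>V i. \<Sum>b\<in>V k. \<Sum>c\<in>V l. if P1 a b \<and> P2 a c \<and> P3 b c
      then 2 * \<epsilon> - of_bool (({a, b, c} \<in> EG) = ({i, k, l} \<in> EH)) else 0)"
    unfolding G_def by (intro sum.cong refl w)
  with y(2) show ?thesis unfolding sparse_triad_def by auto
qed

text \<open>Place \<open>l\<close> freely, then impose the triples through \<open>l\<close> one by
  one, at most \<open>t\<^sup>2\<close> of them; a step keeping less than an \<epsilon>-fraction
  would produce an excluded sparse triad. Induction over all proper subsets is used because the size
  of that triad is measured against maps on \<open>S\<close> without three vertices.\<close>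

lemma correct_maps_extend:
  fixes \<epsilon> :: real and N t :: nat
  assumes V: "\<And>i. i \<in> S \<Longrightarrow> finite (V i)" "\<And>i. i \<in> S \<Longrightarrow> card (V i) = N"
    and eps: "0 < \<epsilon>" "\<epsilon> \<le> 1"
    and none: "\<And>i k l. i \<in> S \<Longrightarrow> k \<in> S \<Longrightarrow> l \<in> S \<Longrightarrow> i \<noteq> k \<Longrightarrow> i \<noteq> l \<Longrightarrow> k \<noteq> l \<Longrightarrow>
      \<not> sparse_triad EG \<epsilon> (\<epsilon> * (\<epsilon> ^ t\<^sup>2 * N) ^ 3) (V i) (V k) (V l)"
    and S: "finite S" "card S \<le> t" and l: "l \<in> S"
  shows "\<epsilon> ^ t\<^sup>2 * N * card (correct_maps EH EG V (S - {l}) ([S - {l}]\<^bsup>3\<^esup>))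
    \<le> card (correct_maps EH EG V S ([S]\<^bsup>3\<^esup>))"
  using S(1) V none S(2) l
proof (induction S arbitrary: l rule: finite_psubset_induct)
  case (psubset S l)
  let ?n = "\<lambda>S C. real (card (correct_maps EH EG V S C))"
  let ?\<eta> = "\<epsilon> ^ t\<^sup>2"
  have IH: "?\<eta> * N * ?n (S' - {j}) ([S' - {j}]\<^bsup>3\<^esup>) \<le> ?n S' ([S']\<^bsup>3\<^esup>)"
    if "S' \<subset> S" "j \<in> S'" for S' j
  proof (rule psubset.IH)
    show "card S' \<le> t" using that psubset.hyps psubset.prems(4) by (meson less_imp_le order_trans psubset_card_mono)
    show "\<not> sparse_triad EG \<epsilon> (\<epsilon> * (?\<eta> * N) ^ 3) (V i) (V k) (V l)"
      if "i \<in> S'" "k \<in> S'" "l \<in> S'" "i \<noteq> k" "i \<noteq> l" "k \<noteq> l" for i k l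
      using that \<open>S' \<subset> S\<close> by (intro psubset.prems(3)) auto
    show "finite (V i)" "card (V i) = N" if "i \<in> S'" for i
      using that \<open>S' \<subset> S\<close> psubset.prems(1,2) by auto
  qed (use that in auto)
  define S' where "S' = S - {l}"
  have S: "S = insert l S'" "l \<notin> S'" "finite S'" using psubset.prems psubset.hyps by (auto simp: S'_def)
  \<comment> \<open>\<open>F\<close> holds the pairs whose triples with \<open>l\<close> have
    already been imposed.\<close>
  have step: "\<epsilon> ^ card F * (N * ?n S' ([S']\<^bsup>3\<^esup>)) \<le> ?n S ([S']\<^bsup>3\<^esup> \<union> insert l ` F)"
    if "finite F" "F \<subseteq> [S']\<^bsup>2\<^esup>" for F
    using that
  proof (induction F rule: finite_subset_induct')
    \<comment> \<open>No constraint involves \<open>l\<close> yet, so each correct map on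
      \<open>S'\<close> has exactly \<open>N\<close> extensions.\<close>
    case empty
    have "?n S ([S']\<^bsup>3\<^esup>) = (\<Sum>x\<in>PiE S V. of_bool (x \<in> correct_maps EH EG V S ([S']\<^bsup>3\<^esup>)))"
      using psubset.hyps psubset.prems(1)
      by (subst sum_of_bool_eq) (auto simp: correct_maps_def Int_def intro!: finite_PiE arg_cong[where f = card])
    also have "\<dots> = (\<Sum>y\<in>PiE S' V. \<Sum>a\<in>V l. of_bool (y(l := a) \<in> correct_maps EH EG V S ([S']\<^bsup>3\<^esup>)))"
      unfolding S(1) using S(2) by (rule sum_PiE_insert)
    also have "\<dots> = (\<Sum>y\<in>PiE S' V. \<Sum>a\<in>V l. of_bool (y \<in> correct_maps EH EG V S' ([S']\<^bsup>3\<^esup>)))"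
    proof (intro sum.cong refl arg_cong[where f = of_bool])
      fix y a assume y: "y \<in> PiE S' V" "a \<in> V l"
      have "y(l := a) \<in> PiE (insert l S') V" using y by (intro PiE_fun_upd) auto
      moreover have "y(l := a) ` T = y ` T" if "T \<in> [S']\<^bsup>3\<^esup>" for T
        using that S(2) by (intro image_cong) (auto simp: nsets_def)
      ultimately show "y(l := a) \<in> correct_maps EH EG V S ([S']\<^bsup>3\<^esup>) \<longleftrightarrow> y \<in> correct_maps EH EG V S' ([S']\<^bsup>3\<^esup>)"
        unfolding correct_maps_def S(1) mem_Collect_eq using y(1) by metis
    qed
    also have "\<dots> = N * ?n S' ([S']\<^bsup>3\<^esup>)"
      using psubset.prems(1,2,5) S(1,3)
      by (auto simp: sum_distrib_left[symmetric] correct_maps_def Int_def finite_PiE intro!: arg_cong[where f = card])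
    finally show ?case by simp
  next
    case (insert e F)
    obtain i k where ik: "e = {i, k}" "i \<noteq> k" "i \<in> S'" "k \<in> S'"
      using insert.hyps(2) by (auto simp: nsets_def card_2_iff)
    let ?C = "[S']\<^bsup>3\<^esup> \<union> insert l ` F"
    have T: "insert l e = {i, k, l}" using ik by auto
    have lF: "l \<notin> f" "card f = 2" "f \<subseteq> S'" "finite f" if "f \<in> F" for f
      using that insert.hyps(3) S(2) by (auto simp: nsets_def)
    have "?C \<subseteq> [S]\<^bsup>3\<^esup>"
      using lF unfolding S(1) nsets_def by auto
    moreover have "{i, k, l} \<notin> ?C"
    proof
      assume "{i, k, l} \<in> ?C"
      then obtain f where "f \<in> F" "insert l e = insert l f"
        using S(2) T by (auto simp: nsets_def)
      then have "e = f" using lF[of f] ik S(2) by (metis insert_ident insertE singletonD)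
      with \<open>f \<in> F\<close> insert.hyps show False by simp
    qed
    moreover have "[S - {i, k, l}]\<^bsup>3\<^esup> \<subseteq> ?C" by (auto simp: nsets_def S'_def)
    \<comment> \<open>This is \<open>large\<close> with \<mu> the cube of
      \<open>?\<eta> * N\<close>: the induction hypothesis adds back \<open>i\<close> and then
      \<open>k\<close>, and the third factor comes from placing \<open>l\<close> under the
      constraints in \<open>F\<close>, since \<open>card F \<le> t\<^sup>2\<close>.\<close>
    moreover have "?\<eta> * N * (?\<eta> * N * (?\<eta> * N * ?n (S - {i, k, l}) ([S - {i, k, l}]\<^bsup>3\<^esup>)))
        \<le> ?n S ?C"
    proof -
      have eq: "S' - {k} - {i} = S - {i, k, l}" by (auto simp: S'_def)
      have "?\<eta> * N * ?n (S - {i, k, l}) ([S - {i, k, l}]\<^bsup>3\<^esup>) \<le> ?n (S' - {k}) ([S' - {k}]\<^bsup>3\<^esup>)"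
        unfolding eq[symmetric] using ik S by (intro IH) auto
      then have "?\<eta> * N * (?\<eta> * N * ?n (S - {i, k, l}) ([S - {i, k, l}]\<^bsup>3\<^esup>))
          \<le> ?\<eta> * N * ?n (S' - {k}) ([S' - {k}]\<^bsup>3\<^esup>)"
        using eps by (intro mult_left_mono) auto
      also have "\<dots> \<le> ?n S' ([S']\<^bsup>3\<^esup>)" using ik S by (intro IH) auto
      finally have "?\<eta> * N * (?\<eta> * N * (?\<eta> * N * ?n (S - {i, k, l}) ([S - {i, k, l}]\<^bsup>3\<^esup>)))
          \<le> ?\<eta> * N * ?n S' ([S']\<^bsup>3\<^esup>)"
        using eps by (intro mult_left_mono) auto
      also have "\<dots> \<le> \<epsilon> ^ card F * (N * ?n S' ([S']\<^bsup>3\<^esup>))"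
      proof -
        have "card F \<le> card ([S']\<^bsup>2\<^esup>)"
          using insert.hyps(3) S(3) by (intro card_mono finite_imp_finite_nsets) auto
        also have "\<dots> \<le> (card S')\<^sup>2"
          by (simp add: card_nsets choose_two power2_eq_square)
             (metis div_le_dividend diff_le_self le_trans mult_le_mono2)
        also have "\<dots> \<le> t\<^sup>2" using psubset.prems(4) S by (intro power_mono) auto
        finally have "?\<eta> \<le> \<epsilon> ^ card F" using eps by (intro power_decreasing) auto
        then show ?thesis by (simp add: mult.assoc mult_right_mono)
      qed
      also have "\<dots> \<le> ?n S ?C" using insert.IH insert.prems by auto
      finally show ?thesis .
    qed
    ultimately have failing: "sparse_triad EG \<epsilon> (\<epsilon> * (?\<eta> * N) ^ 3) (V i) (V k) (V l)"
      if "?n S (insert {i, k, l} ?C) < \<epsilon> * ?n S ?C"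
      by (intro triad_of_failing_triple[OF psubset.hyps psubset.prems(1) _ _ _ _ _ _ _ _ _ eps(1) that])
         (use ik S in \<open>auto simp only: power3_eq_cube mult.assoc insert_iff\<close>)
    have "\<epsilon> * ?n S ?C \<le> ?n S (insert {i, k, l} ?C)"
      using failing psubset.prems(3)[of i k l] ik S by (metis insertCI linorder_not_le)
    moreover have "insert {i, k, l} ?C = [S']\<^bsup>3\<^esup> \<union> insert l ` insert e F" using T by auto
    moreover have "\<epsilon> * (\<epsilon> ^ card F * (N * ?n S' ([S']\<^bsup>3\<^esup>))) \<le> \<epsilon> * ?n S ?C"
      using insert.IH insert.prems eps by (intro mult_left_mono) auto
    ultimately show ?case using insert.hyps by (simp add: mult.assoc)
  qed
  have eq: "[S']\<^bsup>3\<^esup> \<union> insert l ` [S']\<^bsup>2\<^esup> = [S]\<^bsup>3\<^esup>"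
  proof (intro equalityI subsetI)
    fix T assume T: "T \<in> [S]\<^bsup>3\<^esup>"
    show "T \<in> [S']\<^bsup>3\<^esup> \<union> insert l ` [S']\<^bsup>2\<^esup>"
    proof (cases "l \<in> T")
      case True
      then have "T = insert l (T - {l})" "T - {l} \<in> [S']\<^bsup>2\<^esup>" using T S by (auto simp: nsets_def)
      then show ?thesis by blast
    qed (use T S in \<open>auto simp: nsets_def\<close>)
  qed (use S in \<open>auto simp: nsets_def card_insert_if\<close>)
  have "?\<eta> \<le> \<epsilon> ^ card ([S']\<^bsup>2\<^esup>)"
  proof -
    have "card ([S']\<^bsup>2\<^esup>) \<le> (card S')\<^sup>2"
      by (simp add: card_nsets choose_two power2_eq_square)
         (metis div_le_dividend diff_le_self le_trans mult_le_mono2)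
    also have "\<dots> \<le> t\<^sup>2" using psubset.prems(4) S by (intro power_mono) auto
    finally show ?thesis using eps by (intro power_decreasing) auto
  qed
  then have "?\<eta> * (N * ?n S' ([S']\<^bsup>3\<^esup>)) \<le> \<epsilon> ^ card ([S']\<^bsup>2\<^esup>) * (N * ?n S' ([S']\<^bsup>3\<^esup>))"
    by (intro mult_right_mono) auto
  also have "\<dots> \<le> ?n S ([S]\<^bsup>3\<^esup>)"
    unfolding eq[symmetric] using S(3) by (intro step finite_imp_finite_nsets) auto
  finally show ?case unfolding S'_def mult.assoc .
qed

text \<open>Starting from the one map on no vertices, each added vertex multiplies the number of
  correct maps by at least a positive factor. The contrapositive supplies a sparse triad.\<close>

lemma correct_map_exists:
  fixes \<epsilon> :: real and N t :: nat
  assumes V: "\<And>i. i \<in> S \<Longrightarrow> finite (V i)" "\<And>i. i \<in> S \<Longrightarrow> card (V i) = N"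
    and eps: "0 < \<epsilon>" "\<epsilon> \<le> 1" and N: "0 < N"
    and none: "\<And>i k l. i \<in> S \<Longrightarrow> k \<in> S \<Longrightarrow> l \<in> S \<Longrightarrow> i \<noteq> k \<Longrightarrow> i \<noteq> l \<Longrightarrow> k \<noteq> l \<Longrightarrow>
      \<not> sparse_triad EG \<epsilon> (\<epsilon> * (\<epsilon> ^ t\<^sup>2 * N) ^ 3) (V i) (V k) (V l)"
    and S: "finite S" "card S \<le> t"
  shows "correct_maps EH EG V S ([S]\<^bsup>3\<^esup>) \<noteq> {}"
  using S(1) V none S(2)
proof (induction S rule: finite_induct)
  case empty
  show ?case by (simp add: correct_maps_def nsets_def)
next
  case (insert l S)
  let ?n = "\<lambda>S. real (card (correct_maps EH EG V S ([S]\<^bsup>3\<^esup>)))"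
  have "correct_maps EH EG V S ([S]\<^bsup>3\<^esup>) \<noteq> {}"
    using insert by auto
  then have "0 < ?n S" using insert.hyps insert.prems(1) by (simp add: card_gt_0_iff finite_correct_maps)
  then have "0 < \<epsilon> ^ t\<^sup>2 * N * ?n S" using eps N by simp
  also have "\<dots> \<le> ?n (insert l S)"
    using correct_maps_extend[of "insert l S" V N \<epsilon> EG t l EH] insert eps by simp
  finally show ?case by (simp add: card_gt_0_iff)
qed

section \<open>Choice of parameters\<close>

text \<open>Here \<open>exp L\<close> plays the role of the number of vertices. The inequalities
  \<open>L\<close> are what \<open>triad_empty_tripartite\<close> requires once \<open>s\<close>,
  \<open>p\<close>, \<open>q\<close> are rounded to integers; as assumptions they can be discharged
  asymptotically later.\<close>

lemma sparse_triad_tripartite: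
  fixes \<delta> L c :: real
  assumes triad: "sparse_triad EG (L powr (-3 * \<delta>)) (L powr (-3 * \<delta>) * ((L powr (-3 * \<delta>)) ^ t\<^sup>2 * N) ^ 3) A B C"
    and fin: "finite A" "finite B" "finite C"
    and card: "card A = N" "card B = N" "card C = N"
    and delta: "0 < \<delta>" "\<delta> = 1 / (55 * (real t)\<^sup>2)"
    and N: "c * exp L \<le> N"
    and L: "8 \<le> L" "L powr (-3 * \<delta>) \<le> 1 / 16"
      "L / 4 \<le> L powr (-9/55) / 8 * (c * exp L)"
      "2 * exp (L powr (1/2)) \<le> L powr (-9/55) / 16 * (c * exp L) / exp (L / 4)"
      "4 * L powr (1/2 + \<delta>) \<le> L powr (-18/55) * (L / 8) / 128"
      "2 * L powr (1/2 + \<delta>) \<le> exp (-32 * L powr (1/2 - 2 * \<delta>)) * (L powr (-9/55) * exp (L powr (1/2 - 3/2 * \<delta>)) / 32)"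
      "2 * L powr (1/2 + \<delta>) * (exp (L / 4) * exp (4 * L powr (1 - \<delta> / 2))) \<le> L powr (-9/55) / 8 * (c * exp L)"
  obtains U V W where "U \<subseteq> A" "V \<subseteq> B" "W \<subseteq> C"
    "L powr (1/2 + \<delta>) \<le> card U" "L powr (1/2 + \<delta>) \<le> card V" "L powr (1/2 + \<delta>) \<le> card W"
    "complete_tripartite EG U V W \<or> empty_tripartite EG U V W"
proof -
  define \<epsilon> where "\<epsilon> = L powr (-3 * \<delta>)"
  define \<kappa> where "\<kappa> = L powr (-9/55)"
  define s where "s = nat \<lceil>L powr (1/2 + \<delta>)\<rceil>"
  \<comment> \<open>With this choice \<open>2 ^ p\<close> is at most the fourth root of
    \<open>exp L\<close>.\<close>
  define p where "p = nat \<lfloor>L / 4\<rfloor>"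
  \<comment> \<open>The exponent of \<open>L\<close> in \<open>ln q\<close> must exceed
    \<open>1/2 - 2 * \<delta>\<close>, so that \<open>q\<close> outweighs the loss
    \<open>(1 - 8 * \<epsilon>) ^ s\<close>, and stay below \<open>1/2 - \<delta>\<close>, so that
    \<open>ln (q ^ s)\<close> is of smaller order than \<open>L\<close>; the midpoint is
    taken.\<close>
  define q where "q = nat \<lceil>exp (L powr (1/2 - 3/2 * \<delta>))\<rceil>"
  have eps: "0 < \<epsilon>" "\<epsilon> \<le> 1 / 16" using L by (auto simp: \<epsilon>_def)
  have kap: "0 < \<kappa>" using L by (simp add: \<kappa>_def)
  have s: "L powr (1/2 + \<delta>) \<le> s" "s \<le> 2 * L powr (1/2 + \<delta>)" "0 < s"
  proof -
    have "1 \<le> L powr (1/2 + \<delta>)" using L(1) delta by (intro ge_one_powr_ge_zero) auto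
    then show "L powr (1/2 + \<delta>) \<le> s" "s \<le> 2 * L powr (1/2 + \<delta>)" "0 < s"
      unfolding s_def by linarith+
  qed
  have q: "exp (L powr (1/2 - 3/2 * \<delta>)) \<le> q" "q \<le> 2 * exp (L powr (1/2 - 3/2 * \<delta>))"
  proof -
    have "1 \<le> exp (L powr (1/2 - 3/2 * \<delta>))" by simp
    then show "exp (L powr (1/2 - 3/2 * \<delta>)) \<le> q" "q \<le> 2 * exp (L powr (1/2 - 3/2 * \<delta>))"
      unfolding q_def by linarith+
  qed
  have p: "L / 8 \<le> p" "p \<le> L / 4" "0 < p" using L(1) unfolding p_def by linarith+
  have "2 ^ p \<le> exp (real p)"
  proof -
    have "(2::real) ^ p \<le> exp 1 ^ p" using exp_ge_add_one_self[of 1] by (intro power_mono) auto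
    then show ?thesis by (simp add: exp_of_nat_mult[symmetric])
  qed
  also have "\<dots> \<le> exp (L / 4)" using p by simp
  finally have p2: "2 ^ p \<le> exp (L / 4)" .
  have L1: "1 \<le> L" using L(1) by simp
  have powr_mult: "(L powr x) ^ k = L powr (x * k)" for x k
    using L1 by (simp add: powr_powr powr_realpow[symmetric])
  \<comment> \<open>The three factors \<open>\<epsilon> ^ t\<^sup>2\<close> combine to a power of
    \<open>L\<close> independent of \<open>t\<close>; this cancellation is the reason for
    \<open>(real t)\<^sup>2\<close> in the denominator of \<delta>.\<close>
  have "-3 * \<delta> * real (t\<^sup>2) * real 3 = -9 * (\<delta> * (real t)\<^sup>2)" by simp
  also have "\<delta> * (real t)\<^sup>2 = 1 / 55" using delta by (auto simp: field_simps)
  finally have exponent: "-3 * \<delta> * real (t\<^sup>2) * real 3 = -9 / 55" by simp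
  have k: "(\<epsilon> ^ t\<^sup>2) ^ 3 = \<kappa>"
    unfolding \<epsilon>_def \<kappa>_def powr_mult exponent ..
  obtain P1 P2 P3 \<sigma> where P: "\<epsilon> * (\<epsilon> ^ t\<^sup>2 * N) ^ 3 \<le> (\<Sum>a\<in>A. \<Sum>b\<in>B. \<Sum>c\<in>C.
     if P1 a b \<and> P2 a c \<and> P3 b c then 2 * \<epsilon> - of_bool (({a, b, c} \<in> EG) = \<sigma>) else 0)"
    using triad unfolding sparse_triad_def \<epsilon>_def by blast
  have N': "\<kappa> / x * (c * exp L) \<le> \<kappa> / x * N" if "0 \<le> x" for x
    using N kap that by (intro mult_left_mono) auto
  have "0 < c"
  proof -
    have "0 < L powr (-9/55) / 8 * (c * exp L)" using L(1,3) by linarith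
    then show ?thesis using L1 by (simp add: zero_less_mult_iff)
  qed
  obtain U V W where UVW: "U \<subseteq> A" "V \<subseteq> B" "W \<subseteq> C" "s \<le> card U" "s \<le> card V" "s \<le> card W"
    "\<forall>a\<in>U. \<forall>b\<in>V. \<forall>c\<in>W. \<not> (({a, b, c} \<in> EG) = \<sigma>)"
  proof (rule triad_empty_tripartite[OF fin card eps kap s(3) p(3)])
    show "real p \<le> \<kappa> / 8 * N" using L(3) p(2) N'[of 8] unfolding \<kappa>_def by linarith
    show "real q \<le> \<kappa> / 16 * N / 2 ^ p"
    proof -
      have "q \<le> 2 * exp (L powr (1/2))"
        using q(2) by (rule order_trans) (use L1 delta in \<open>simp add: powr_mono\<close>)
      also have "\<dots> \<le> \<kappa> / 16 * (c * exp L) / exp (L / 4)" using L(4) by (simp add: \<kappa>_def)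
      also have "\<dots> \<le> \<kappa> / 16 * N / 2 ^ p"
        using p2 kap N'[of 16] \<open>0 < c\<close> by (intro frac_le) auto
      finally show ?thesis .
    qed
    show "real (2 * s) \<le> \<kappa>\<^sup>2 * p / 128"
    proof -
      have "real (2 * s) \<le> \<kappa>\<^sup>2 * (L / 8) / 128" using s(2) L(5) unfolding \<kappa>_def powr_mult by simp
      also have "\<dots> \<le> \<kappa>\<^sup>2 * p / 128" using p(1) by (intro divide_right_mono mult_left_mono) auto
      finally show ?thesis .
    qed
    show "s \<le> (1 - 8 * \<epsilon>) ^ s * (\<kappa> * q / 32)"
    proof -
      have "exp (-16 * \<epsilon>) \<le> 1 - 8 * \<epsilon>"
      proof -
        have "1 + 16 * \<epsilon> \<le> exp (16 * \<epsilon>)" by (rule exp_ge_add_one_self)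
        moreover have "1 \<le> (1 - 8 * \<epsilon>) * (1 + 16 * \<epsilon>)"
          using mult_nonneg_nonneg[of "8 * \<epsilon>" "1 - 16 * \<epsilon>"] eps by (simp add: algebra_simps)
        ultimately have "1 \<le> (1 - 8 * \<epsilon>) * exp (16 * \<epsilon>)"
          using mult_left_mono[of "1 + 16 * \<epsilon>" "exp (16 * \<epsilon>)" "1 - 8 * \<epsilon>"] eps by linarith
        then show ?thesis by (simp add: exp_minus field_simps)
      qed
      then have "exp (-16 * \<epsilon>) ^ s \<le> (1 - 8 * \<epsilon>) ^ s" by (intro power_mono) auto
      moreover have "exp (-16 * \<epsilon>) ^ s = exp (-(16 * (\<epsilon> * s)))" by (simp add: exp_of_nat_mult[symmetric] mult_ac)
      moreover have "\<epsilon> * s \<le> 2 * L powr (1/2 - 2 * \<delta>)"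
      proof -
        have "\<epsilon> * s \<le> L powr (-3 * \<delta>) * (2 * L powr (1/2 + \<delta>))"
          unfolding \<epsilon>_def using s(2) by (intro mult_left_mono) auto
        also have "\<dots> = 2 * L powr (-3 * \<delta> + (1/2 + \<delta>))" unfolding powr_add by simp
        also have "-3 * \<delta> + (1/2 + \<delta>) = 1/2 - 2 * \<delta>" by simp
        finally show ?thesis .
      qed
      then have "exp (-32 * L powr (1/2 - 2 * \<delta>)) \<le> exp (-(16 * (\<epsilon> * s)))" by simp
      ultimately have e: "exp (-32 * L powr (1/2 - 2 * \<delta>)) \<le> (1 - 8 * \<epsilon>) ^ s" by linarith
      have "s \<le> exp (-32 * L powr (1/2 - 2 * \<delta>)) * (\<kappa> * exp (L powr (1/2 - 3/2 * \<delta>)) / 32)"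
        using s(2) L(6) by (simp add: \<kappa>_def)
      also have "\<dots> \<le> (1 - 8 * \<epsilon>) ^ s * (\<kappa> * q / 32)"
        using e q(1) kap eps by (intro mult_mono) auto
      finally show ?thesis .
    qed
    show "real (s * (2 ^ p * q ^ s)) \<le> \<kappa> / 8 * N"
    proof -
      \<comment> \<open>The factor 2 lost by rounding \<open>q\<close> up is absorbed by doubling
        the exponent.\<close>
      have "real q \<le> exp (2 * L powr (1/2 - 3/2 * \<delta>))"
      proof -
        have "2 \<le> exp (L powr (1/2 - 3/2 * \<delta>))"
        proof -
          have "t \<noteq> 0" using delta by auto
          then have "1 \<le> (real t)\<^sup>2" by simp
          then have "\<delta> \<le> 1 / 55" unfolding delta(2) by (intro frac_le) auto
          then have "1 \<le> L powr (1/2 - 3/2 * \<delta>)" using L1 by (intro ge_one_powr_ge_zero) auto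
          then show ?thesis using exp_ge_add_one_self[of "L powr (1/2 - 3/2 * \<delta>)"] by linarith
        qed
        then have "2 * exp (L powr (1/2 - 3/2 * \<delta>)) \<le> exp (L powr (1/2 - 3/2 * \<delta>)) * exp (L powr (1/2 - 3/2 * \<delta>))"
          by (intro mult_right_mono) auto
        with q(2) show ?thesis by (simp add: exp_add[symmetric])
      qed
      then have "real q ^ s \<le> exp (2 * L powr (1/2 - 3/2 * \<delta>)) ^ s" by (intro power_mono) auto
      also have "\<dots> = exp (real s * (2 * L powr (1/2 - 3/2 * \<delta>)))" by (simp add: exp_of_nat_mult)
      also have "\<dots> \<le> exp (4 * L powr (1 - \<delta> / 2))"
      proof -
        have "real s * (2 * L powr (1/2 - 3/2 * \<delta>)) \<le> 2 * L powr (1/2 + \<delta>) * (2 * L powr (1/2 - 3/2 * \<delta>))"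
          using s(2) by (intro mult_right_mono) auto
        also have "\<dots> = 4 * L powr (1/2 + \<delta> + (1/2 - 3/2 * \<delta>))" unfolding powr_add by simp
        also have "1/2 + \<delta> + (1/2 - 3/2 * \<delta>) = 1 - \<delta> / 2" by simp
        finally show ?thesis by simp
      qed
      finally have qs: "real q ^ s \<le> exp (4 * L powr (1 - \<delta> / 2))" .
      have "real (s * (2 ^ p * q ^ s)) \<le> 2 * L powr (1/2 + \<delta>) * (exp (L / 4) * exp (4 * L powr (1 - \<delta> / 2)))"
        using s(2) p2 qs by (simp only: of_nat_mult of_nat_power of_nat_numeral) (intro mult_mono, auto)
      also have "\<dots> \<le> \<kappa> / 8 * N" using L(7) N'[of 8] by (simp add: \<kappa>_def)
      finally show ?thesis .
    qed
    show "\<epsilon> * \<kappa> * N ^ 3 \<le> (\<Sum>a\<in>A. \<Sum>b\<in>B. \<Sum>c\<in>C.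
     if P1 a b \<and> P2 a c \<and> P3 b c then 2 * \<epsilon> - of_bool (({a, b, c} \<in> EG) = \<sigma>) else 0)"
      using P by (simp add: power_mult_distrib k mult.assoc)
  qed
  show thesis
  proof (rule that[OF UVW(1-3)])
    show "complete_tripartite EG U V W \<or> empty_tripartite EG U V W"
      using UVW(7) by (cases \<sigma>) (auto simp: complete_tripartite_def empty_tripartite_def)
  qed (use s(1) UVW(4-6) in \<open>linarith+\<close>)
qed

section \<open>Disjoint vertex parts and assembly of the theorem\<close>

lemma disjoint_subsets_exist:
  assumes "finite I" "finite X" "card I * N \<le> card X"
  obtains V where "\<And>i. i \<in> I \<Longrightarrow> V i \<subseteq> X" "\<And>i. i \<in> I \<Longrightarrow> card (V i) = N"
    "\<And>i j. i \<in> I \<Longrightarrow> j \<in> I \<Longrightarrow> i \<noteq> j \<Longrightarrow> V i \<inter> V j = {}"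
proof -
  have "\<exists>f. f ` (I \<times> {..<N}) \<subseteq> X \<and> inj_on f (I \<times> {..<N})"
    using assms by (intro card_le_inj) (auto simp: card_cartesian_product)
  then obtain f where f: "f ` (I \<times> {..<N}) \<subseteq> X" "inj_on f (I \<times> {..<N})" by blast
  show thesis
  proof (rule that[of "\<lambda>i. f ` ({i} \<times> {..<N})"])
    show "card (f ` ({i} \<times> {..<N})) = N" if "i \<in> I" for i
    proof -
      have "inj_on f ({i} \<times> {..<N})" by (rule inj_on_subset[OF f(2)]) (use that in auto)
      then show ?thesis by (simp add: card_image card_cartesian_product)
    qed
    show "f ` ({i} \<times> {..<N}) \<inter> f ` ({j} \<times> {..<N}) = {}" if "i \<in> I" "j \<in> I" "i \<noteq> j" for i j
      using that inj_onD[OF f(2)] by fastforce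
  qed (use f in auto)
qed

lemma contains_induced_copy_if_correct_map:
  assumes x: "x \<in> correct_maps EH EG V S ([S]\<^bsup>3\<^esup>)"
    and V: "\<And>i. i \<in> S \<Longrightarrow> V i \<subseteq> VG" "\<And>i j. i \<in> S \<Longrightarrow> j \<in> S \<Longrightarrow> i \<noteq> j \<Longrightarrow> V i \<inter> V j = {}"
  shows "contains_induced_copy S EH VG EG"
proof -
  have mem: "x i \<in> V i" if "i \<in> S" for i using x that by (auto simp: correct_maps_def)
  have "inj_on x S"
    using mem V(2) by (intro inj_onI) (metis disjoint_iff)
  then show ?thesis
    unfolding contains_induced_copy_def using x mem V(1)
    by (intro exI[of _ x]) (auto simp: correct_maps_def)
qed

theorem theorem3p4:
  fixes VH :: "'a set" and EH :: "'a set set" and t :: nat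
  assumes "three_uniform_hypergraph VH EH" and "card VH = t"
  shows "\<forall>\<^sub>F n in sequentially.
           \<forall>(VG :: 'b set) EG.
             three_uniform_hypergraph VG EG \<and> card VG = n \<and> induced_free VH EH VG EG \<longrightarrow>
             (\<exists>U V W.
                U \<subseteq> VG \<and> V \<subseteq> VG \<and> W \<subseteq> VG \<and>
                U \<inter> V = {} \<and> U \<inter> W = {} \<and> V \<inter> W = {} \<and>
                real (card U) \<ge> ln (real n) powr (1 / 2 + delta t) \<and>
                real (card V) \<ge> ln (real n) powr (1 / 2 + delta t) \<and>
                real (card W) \<ge> ln (real n) powr (1 / 2 + delta t) \<and>
                (complete_tripartite EG U V W \<or> empty_tripartite EG U V W))"
proof (cases "t = 0")
  case True
  then have "VH = {}" using assms by (simp add: three_uniform_hypergraph_def)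
  then have "\<not> induced_free VH EH VG EG" for VG :: "'b set" and EG
    by (simp add: induced_free_def contains_induced_copy_def nsets_def)
  then show ?thesis by simp
next
  case False
  define \<delta> where "\<delta> = delta t"
  \<comment> \<open>Parts of size \<open>n div t\<close> have at least \<open>n / (2 * t)\<close>
    vertices once \<open>n \<ge> t\<close>.\<close>
  define c where "c = 1 / (2 * real t)"
  have finH: "finite VH" using assms by (simp add: three_uniform_hypergraph_def)
  have delta: "0 < \<delta>" "\<delta> = 1 / (55 * (real t)\<^sup>2)" using False by (auto simp: \<delta>_def delta_def)
  have "1 \<le> (real t)\<^sup>2" using False by simp
  then have delta55: "\<delta> \<le> 1 / 55" unfolding delta(2) by (intro frac_le) auto
  have c0: "0 < c" using False by (simp add: c_def)
  let ?P = "\<lambda>L. 8 \<le> L \<and> L powr (-3 * \<delta>) \<le> 1 / 16 \<and>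
      L / 4 \<le> L powr (-9/55) / 8 * (c * exp L) \<and>
      2 * exp (L powr (1/2)) \<le> L powr (-9/55) / 16 * (c * exp L) / exp (L / 4) \<and>
      4 * L powr (1/2 + \<delta>) \<le> L powr (-18/55) * (L / 8) / 128 \<and>
      2 * L powr (1/2 + \<delta>) \<le> exp (-32 * L powr (1/2 - 2 * \<delta>)) * (L powr (-9/55) * exp (L powr (1/2 - 3/2 * \<delta>)) / 32) \<and>
      2 * L powr (1/2 + \<delta>) * (exp (L / 4) * exp (4 * L powr (1 - \<delta> / 2))) \<le> L powr (-9/55) / 8 * (c * exp L)"
  \<comment> \<open>The decisive exponents: the fifth condition needs
    \<open>1/2 + \<delta> < 37/55\<close>, which \<open>\<delta> \<le> 1/55\<close> gives; the sixth
    and seventh rest on \<open>1/2 - 2 * \<delta> < 1/2 - 3/2 * \<delta>\<close> and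
    \<open>1 - \<delta> / 2 < 1\<close>.\<close>
  have "eventually ?P at_top"
    using delta(1) delta55 c0 by (intro eventually_conj) real_asymp+
  moreover have "filterlim (\<lambda>n::nat. ln (real n)) at_top sequentially" by real_asymp
  ultimately have "eventually (\<lambda>n. ?P (ln (real n))) sequentially"
    by (rule eventually_compose_filterlim)
  then show ?thesis
    using eventually_ge_at_top[of "2 * t"]
  proof eventually_elim
    case (elim n)
    have n: "0 < n" "2 * t \<le> n" using elim(2) False by auto
    define N where "N = n div t"
    have "n < (N + 1) * t" using False using dividend_less_times_div[of t n] by (simp add: N_def algebra_simps)
    then have "real n \<le> (N + 1) * real t" by (metis less_imp_le of_nat_le_iff of_nat_mult)
    moreover have "1 \<le> N" using n False by (simp add: N_def div_greater_zero_iff Suc_le_eq)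
    then have "(N + 1) * real t \<le> 2 * N * real t" by (intro mult_right_mono) auto
    ultimately have N: "c * exp (ln (real n)) \<le> N" "0 < N" using n False \<open>1 \<le> N\<close> by (auto simp: c_def field_simps)
    show ?case
    proof (intro allI impI, elim conjE)
      fix VG :: "'b set" and EG
      assume G: "three_uniform_hypergraph VG EG" "card VG = n" "induced_free VH EH VG EG"
      let ?L = "ln (real n)"
      let ?\<epsilon> = "?L powr (-3 * \<delta>)"
      have finG: "finite VG" using G by (simp add: three_uniform_hypergraph_def)
      have "card VH * N \<le> card VG" using G assms(2) by (simp add: N_def)
      then obtain V where V: "\<And>i. i \<in> VH \<Longrightarrow> V i \<subseteq> VG" "\<And>i. i \<in> VH \<Longrightarrow> card (V i) = N"
        "\<And>i j. i \<in> VH \<Longrightarrow> j \<in> VH \<Longrightarrow> i \<noteq> j \<Longrightarrow> V i \<inter> V j = {}"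
        using disjoint_subsets_exist[OF finH finG] by metis
      have finV: "finite (V i)" if "i \<in> VH" for i using V(1)[OF that] finG finite_subset by blast
      \<comment> \<open>A correct map would be an induced copy, disjointness of the parts making it
        injective.\<close>
      have "correct_maps EH EG V VH ([VH]\<^bsup>3\<^esup>) = {}"
        using G(3) contains_induced_copy_if_correct_map[of _ EH EG V VH VG] V(1,3)
        unfolding induced_free_def by blast
      moreover have "0 < ?\<epsilon>" "?\<epsilon> \<le> 1" using elim(1) by auto
      ultimately obtain i k l where ikl: "i \<in> VH" "k \<in> VH" "l \<in> VH" "i \<noteq> k" "i \<noteq> l" "k \<noteq> l"
        "sparse_triad EG ?\<epsilon> (?\<epsilon> * (?\<epsilon> ^ t\<^sup>2 * N) ^ 3) (V i) (V k) (V l)"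
        using correct_map_exists[of VH V N ?\<epsilon> EG t EH] finV V(2) N(2) finH assms(2) by blast
      obtain U V' W where UVW: "U \<subseteq> V i" "V' \<subseteq> V k" "W \<subseteq> V l"
        "?L powr (1/2 + \<delta>) \<le> card U" "?L powr (1/2 + \<delta>) \<le> card V'" "?L powr (1/2 + \<delta>) \<le> card W"
        "complete_tripartite EG U V' W \<or> empty_tripartite EG U V' W"
        by (rule sparse_triad_tripartite[OF ikl(7) finV finV finV V(2) V(2) V(2) delta N(1)])
           (use ikl elim(1) in blast)+
      have "U \<inter> V' = {}" "U \<inter> W = {}" "V' \<inter> W = {}"
        using UVW(1-3) V(3) ikl(1-6) by blast+
      moreover have "U \<subseteq> VG" "V' \<subseteq> VG" "W \<subseteq> VG" using UVW(1-3) V(1) ikl(1-3) by blast+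
      ultimately show "\<exists>U V W. U \<subseteq> VG \<and> V \<subseteq> VG \<and> W \<subseteq> VG \<and>
                U \<inter> V = {} \<and> U \<inter> W = {} \<and> V \<inter> W = {} \<and>
                real (card U) \<ge> ?L powr (1 / 2 + delta t) \<and>
                real (card V) \<ge> ?L powr (1 / 2 + delta t) \<and>
                real (card W) \<ge> ?L powr (1 / 2 + delta t) \<and>
                (complete_tripartite EG U V W \<or> empty_tripartite EG U V W)"
        using UVW(4-7) unfolding \<delta>_def by blast
    qed
  qed
qed

end
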